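(* Let $1\le p<\infty$, and let $u:\mathbb{N}\to\mathbb{C}$ and $\phi:\mathbb{N}\to\mathbb{N}$ be such that $uC_\phi$ is a bounded linear operator on $\ell_p$. Then the null space $N(uC_\phi)$ is a complemented subspace of $\ell_p$.
   Context: $\mathbb{N}$ is the set of positive integers; $\ell_p$ is the Banach space of $p$-summable complex sequences, viewed as functions on $\mathbb{N}$. The operator $uC_\phi$ is defined by $uC_\phi(f)=u\cdot(f\circ\phi)$, i.e. $(uC_\phi f)(m)=u(m)f(\phi(m))$. $N(T)=\{f: Tf=0\}$. A closed subspace $E$ of a Banach space $X$ is complemented if there is a closed subspace $F\subseteq X$ with $E\oplus F=X$. *)

theory Defs
  imports "HOL-Analysis.Analysis" "HOL-Library.Function_Algebras"
begin

typedef pnat = "{n::nat. 0 < n}"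
  by auto

definition scale_fun :: "complex \<Rightarrow> ('a \<Rightarrow> complex) \<Rightarrow> 'a \<Rightarrow> complex" where
  "scale_fun c f = (\<lambda>n. c * f n)"

interpretation cfun: vector_space scale_fun
  by unfold_locales (auto simp: scale_fun_def fun_eq_iff algebra_simps)

(* The space l_p over an index type; l_p in the usual sense is the instance with index type pnat.
   The exponent is a parameter, so the space is a set of functions rather than a type. *)
definition lp :: "real \<Rightarrow> ('a \<Rightarrow> complex) set" where
  "lp p = {f. (\<lambda>n. norm (f n) powr p) summable_on UNIV}"

definition lp_norm :: "real \<Rightarrow> ('a \<Rightarrow> complex) \<Rightarrow> real" where
  "lp_norm p f = (\<Sum>\<^sub>\<infinity>n\<in>UNIV. norm (f n) powr p) powr (1 / p)"

definition lp_dist :: "real \<Rightarrow> ('a \<Rightarrow> complex) \<Rightarrow> ('a \<Rightarrow> complex) \<Rightarrow> real" where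
  "lp_dist p f g = lp_norm p (f - g)"

(* The norm topology; see lp_metric_space below for the metric axioms. *)
abbreviation lp_topology :: "real \<Rightarrow> ('a \<Rightarrow> complex) topology" where
  "lp_topology p \<equiv> Metric_space.mtopology (lp p) (lp_dist p)"

definition closed_subspace_lp :: "real \<Rightarrow> ('a \<Rightarrow> complex) set \<Rightarrow> bool" where
  "closed_subspace_lp p E \<longleftrightarrow>
     E \<subseteq> lp p \<and> cfun.subspace E \<and> closedin (lp_topology p) E"

definition complemented_lp :: "real \<Rightarrow> ('a \<Rightarrow> complex) set \<Rightarrow> bool" where
  "complemented_lp p E \<longleftrightarrow>
     closed_subspace_lp p E \<and>
     (\<exists>F. closed_subspace_lp p F \<and> E \<inter> F = {0} \<and> {f + g | f g. f \<in> E \<and> g \<in> F} = lp p)"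

definition bounded_operator_lp ::
  "real \<Rightarrow> (('a \<Rightarrow> complex) \<Rightarrow> ('a \<Rightarrow> complex)) \<Rightarrow> bool" where
  "bounded_operator_lp p T \<longleftrightarrow>
     T ` lp p \<subseteq> lp p \<and>
     (\<forall>f\<in>lp p. \<forall>g\<in>lp p. T (f + g) = T f + T g) \<and>
     (\<forall>c. \<forall>f\<in>lp p. T (scale_fun c f) = scale_fun c (T f)) \<and>
     (\<exists>K. \<forall>f\<in>lp p. lp_norm p (T f) \<le> K * lp_norm p f)"

definition null_space_lp ::
  "real \<Rightarrow> (('a \<Rightarrow> complex) \<Rightarrow> ('a \<Rightarrow> complex)) \<Rightarrow> ('a \<Rightarrow> complex) set" where
  "null_space_lp p T = {f \<in> lp p. T f = 0}"

definition weighted_composition ::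
  "('a \<Rightarrow> complex) \<Rightarrow> ('a \<Rightarrow> 'a) \<Rightarrow> ('a \<Rightarrow> complex) \<Rightarrow> ('a \<Rightarrow> complex)" where
  "weighted_composition u \<phi> f = u * (f \<circ> \<phi>)"

lemma powr_convex_nonneg:
  fixes x y t p :: real
  assumes "1 \<le> p" "0 \<le> x" "0 \<le> y" "0 < t" "t < 1"
  shows "((1 - t) * x + t * y) powr p \<le> (1 - t) * x powr p + t * y powr p"
proof -
  have shrink: "(s * z) powr p \<le> s * z powr p" if "0 < s" "s < 1" "0 \<le> z" for s z :: real
  proof -
    have "s powr p \<le> s powr 1"
      using that assms(1) by (intro powr_mono') auto
    then show ?thesis
      using that by (simp add: powr_mult mult_right_mono)
  qed
  consider "x = 0" | "y = 0" | "0 < x" "0 < y"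
    using assms by linarith
  then show ?thesis
  proof cases
    case 1
    then show ?thesis using shrink[of t y] assms by simp
  next
    case 2
    then show ?thesis using shrink[of "1 - t" x] assms by simp
  next
    case 3
    then show ?thesis
      using convex_onD[OF powr_convex[OF assms(1)], of t x y] assms by simp
  qed
qed

lemma lp_norm_nonneg: "0 \<le> lp_norm p f"
  by (simp add: lp_norm_def)

lemma lp_norm_powr:
  assumes "1 \<le> p"
  shows "lp_norm p f powr p = (\<Sum>\<^sub>\<infinity>n\<in>UNIV. norm (f n) powr p)"
  using assms by (simp add: lp_norm_def powr_powr infsum_nonneg)

lemma lp_norm_eq_0_iff:
  assumes "1 \<le> p" "f \<in> lp p"
  shows "lp_norm p f = 0 \<longleftrightarrow> f = 0"
proof
  assume "lp_norm p f = 0"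
  then have "(\<Sum>\<^sub>\<infinity>n\<in>UNIV. norm (f n) powr p) = 0"
    by (simp add: lp_norm_def)
  then have "norm (f n) powr p = 0" for n
    using assms(2) by (intro nonneg_infsum_le_0D[where A = UNIV]) (auto simp: lp_def)
  then show "f = 0"
    by (auto simp: fun_eq_iff)
qed (use assms in \<open>simp add: lp_norm_def\<close>)

lemma lp_norm_minus: "lp_norm p (- f) = lp_norm p f"
  by (simp add: lp_norm_def)

lemma lp_triangle:
  fixes f g :: "'a \<Rightarrow> complex"
  assumes p: "1 \<le> p" and f: "f \<in> lp p" and g: "g \<in> lp p"
  shows "f + g \<in> lp p" and "lp_norm p (f + g) \<le> lp_norm p f + lp_norm p g"
proof -
  have "f + g \<in> lp p \<and> lp_norm p (f + g) \<le> lp_norm p f + lp_norm p g"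
  proof (cases "f = 0 \<or> g = 0")
    case True
    then show ?thesis
      using f g by (auto simp: lp_norm_nonneg)
  next
    case False
    define a where "a = lp_norm p f"
    define b where "b = lp_norm p g"
    have ab: "0 < a" "0 < b"
      using False lp_norm_eq_0_iff[OF p f] lp_norm_eq_0_iff[OF p g]
        lp_norm_nonneg[of p f] lp_norm_nonneg[of p g] by (auto simp: a_def b_def)
    define t where "t = b / (a + b)"
    have t: "0 < t" "t < 1" "1 - t = a / (a + b)"
      using ab by (auto simp: t_def field_simps)
    define h where "h n = (a + b) powr p *
      ((1 - t) * (norm (f n) powr p / a powr p) + t * (norm (g n) powr p / b powr p))" for n
    have le: "norm ((f + g) n) powr p \<le> h n" for n
    proof -
      have "norm ((f + g) n) \<le> (a + b) * ((1 - t) * (norm (f n) / a) + t * (norm (g n) / b))"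
      proof -
        have "(a + b) * ((1 - t) * (norm (f n) / a)) = norm (f n)"
          unfolding t(3) using ab by simp
        moreover have "(a + b) * (t * (norm (g n) / b)) = norm (g n)"
          unfolding t_def using ab by simp
        ultimately show ?thesis
          using norm_triangle_ineq[of "f n" "g n"] by (simp add: distrib_left)
      qed
      then have "norm ((f + g) n) powr p
          \<le> ((a + b) * ((1 - t) * (norm (f n) / a) + t * (norm (g n) / b))) powr p"
        using p by (intro powr_mono2) auto
      also have "\<dots> = (a + b) powr p * ((1 - t) * (norm (f n) / a) + t * (norm (g n) / b)) powr p"
        using ab t(1,2) by (intro powr_mult) 
      also have "\<dots> \<le> (a + b) powr p *
          ((1 - t) * (norm (f n) / a) powr p + t * (norm (g n) / b) powr p)"
        using ab t(1,2) p by (intro mult_left_mono powr_convex_nonneg) auto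
      also have "\<dots> = h n"
        using ab by (simp add: h_def powr_divide)
      finally show ?thesis .
    qed
    have sf: "(\<lambda>n. norm (f n) powr p) summable_on UNIV"
      and sg: "(\<lambda>n. norm (g n) powr p) summable_on UNIV"
      using f g by (auto simp: lp_def)
    have hf: "((\<lambda>n. norm (f n) powr p) has_sum a powr p) UNIV"
      and hg: "((\<lambda>n. norm (g n) powr p) has_sum b powr p) UNIV"
      using sf sg by (auto simp: a_def b_def lp_norm_powr[OF p] has_sum_infsum)
    have "(h has_sum (a + b) powr p *
        ((1 - t) * (a powr p / a powr p) + t * (b powr p / b powr p))) UNIV"
      unfolding h_def divide_inverse
      by (intro has_sum_cmult_right has_sum_add has_sum_cmult_left hf hg)
    then have hh: "(h has_sum (a + b) powr p) UNIV"
      using ab by simp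
    have s: "(\<lambda>n. norm ((f + g) n) powr p) summable_on UNIV"
      by (rule summable_on_comparison_test[OF has_sum_imp_summable[OF hh]]) (use le in auto)
    have "(\<Sum>\<^sub>\<infinity>n\<in>UNIV. norm ((f + g) n) powr p) \<le> (a + b) powr p"
      using infsum_mono[OF s has_sum_imp_summable[OF hh]] le infsumI[OF hh] by simp
    then have "lp_norm p (f + g) \<le> ((a + b) powr p) powr (1 / p)"
      unfolding lp_norm_def using p by (intro powr_mono2) (auto intro!: infsum_nonneg)
    also have "\<dots> = a + b"
      using p ab by (simp add: powr_powr)
    finally show ?thesis
      using s by (simp add: lp_def a_def b_def)
  qed
  then show "f + g \<in> lp p" and "lp_norm p (f + g) \<le> lp_norm p f + lp_norm p g"
    by auto
qed

lemma lp_subspace: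
  assumes "1 \<le> p"
  shows "cfun.subspace (lp p)"
proof (rule cfun.subspaceI)
  show "0 \<in> lp p"
    by (simp add: lp_def)
  show "scale_fun c f \<in> lp p" if "f \<in> lp p" for c f
    using that by (auto simp: lp_def scale_fun_def norm_mult powr_mult intro: summable_on_cmult_right)
qed (rule lp_triangle(1)[OF assms])

lemma lp_metric_space:
  assumes p: "1 \<le> p"
  shows "Metric_space (lp p) (lp_dist p)"
proof
  fix f g h :: "'a \<Rightarrow> complex"
  have diff: "f - g \<in> lp p" if "f \<in> lp p" "g \<in> lp p" for f g :: "'a \<Rightarrow> complex"
    using that cfun.subspace_diff[OF lp_subspace[OF p]] by blast
  show "0 \<le> lp_dist p f g"
    by (simp add: lp_dist_def lp_norm_nonneg)
  show "lp_dist p f g = lp_dist p g f"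
    using lp_norm_minus[of p "f - g"] by (simp add: lp_dist_def)
  show "lp_dist p f g = 0 \<longleftrightarrow> f = g" if "f \<in> lp p" "g \<in> lp p"
    using lp_norm_eq_0_iff[OF p diff[OF that]] by (simp add: lp_dist_def)
  show "lp_dist p f h \<le> lp_dist p f g + lp_dist p g h"
    if "f \<in> lp p" "g \<in> lp p" "h \<in> lp p"
    using lp_triangle(2)[OF p diff[OF that(1,2)] diff[OF that(2,3)]] by (simp add: lp_dist_def)
qed

end

(* The function (uC_phi f)(m) = u(m) f(phi(m)) vanishes iff f vanishes on S = phi({u \<noteq> 0}), so the
   null space consists of the elements of l_p vanishing on S, and those vanishing off S form a
   closed complement. *)
theory Submission
  imports Defs
begin

text \<open>A single term of a series of nonnegative terms is at most its sum; taking
  \<open>p\<close>-th roots gives the bound. It makes each coordinate functional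
  \<open>f \<mapsto> f n\<close> continuous, which is the source of closedness below.\<close>

lemma norm_le_lp_norm:
  assumes p: "1 \<le> p" and f: "f \<in> lp p"
  shows "norm (f n) \<le> lp_norm p f"
proof -
  have "norm (f n) powr p = (\<Sum>\<^sub>\<infinity>m\<in>{n}. norm (f m) powr p)"
    by simp
  also have "\<dots> \<le> (\<Sum>\<^sub>\<infinity>m\<in>UNIV. norm (f m) powr p)"
    using f by (intro infsum_mono_neutral) (auto simp: lp_def)
  finally have "(norm (f n) powr p) powr (1 / p) \<le> lp_norm p f"
    unfolding lp_norm_def using p by (intro powr_mono2) auto
  then show ?thesis
    using p by (simp add: powr_powr)
qed

definition lp_vanishing :: "real \<Rightarrow> 'a set \<Rightarrow> ('a \<Rightarrow> complex) set" where
  "lp_vanishing p A = {f \<in> lp p. \<forall>n\<in>A. f n = 0}"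

text \<open>This is an intersection of kernels of continuous coordinate functionals. Closedness is
  checked by finding, around each \<open>f\<close> outside the set, a ball that misses it.\<close>

lemma closed_subspace_lp_vanishing:
  fixes A :: "'a set"
  assumes p: "1 \<le> p"
  shows "closed_subspace_lp p (lp_vanishing p A)"
proof -
  interpret Metric_space "lp p :: ('a \<Rightarrow> complex) set" "lp_dist p"
    by (rule lp_metric_space[OF p])
  note sub = lp_subspace[OF p, where 'a = 'a]
  have "cfun.subspace (lp_vanishing p A)"
    using cfun.subspace_0[OF sub] cfun.subspace_add[OF sub] cfun.subspace_scale[OF sub]
    by (intro cfun.subspaceI) (auto simp: lp_vanishing_def scale_fun_def)
  moreover have "closedin mtopology (lp_vanishing p A)"
    unfolding closedin_metric
  proof (intro conjI allI impI)
    show "lp_vanishing p A \<subseteq> lp p"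
      by (auto simp: lp_vanishing_def)
    fix f assume f: "f \<in> lp p - lp_vanishing p A"
    then obtain n where n: "n \<in> A" "f n \<noteq> 0"
      by (auto simp: lp_vanishing_def)
    \<comment> \<open>The radius is the distance from \<open>f n\<close> to 0: if \<open>g n\<close>
      were 0, then \<open>(f - g) n\<close> would equal \<open>f n\<close>, whose norm is not below
      the radius.\<close>
    have "g n \<noteq> 0" if g: "g \<in> mball f (norm (f n))" for g
    proof -
      have "norm ((f - g) n) \<le> lp_norm p (f - g)"
        using f g by (intro norm_le_lp_norm[OF p] cfun.subspace_diff[OF sub]) auto
      also have "\<dots> < norm (f n)"
        using g by (simp add: lp_dist_def)
      finally show ?thesis
        by auto
    qed
    then have "disjnt (lp_vanishing p A) (mball f (norm (f n)))"
      using n by (auto simp: disjnt_def lp_vanishing_def)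
    then show "\<exists>r>0. disjnt (lp_vanishing p A) (mball f r)"
      using n by (intro exI[of _ "norm (f n)"]) simp
  qed
  ultimately show ?thesis
    by (auto simp: closed_subspace_lp_def lp_vanishing_def)
qed

lemma lp_restrict:
  assumes "f \<in> lp p"
  shows "(\<lambda>n. if n \<in> A then f n else 0) \<in> lp p"
proof -
  have "(\<lambda>n. norm (f n) powr p) summable_on UNIV"
    using assms by (simp add: lp_def)
  then show ?thesis
    unfolding lp_def mem_Collect_eq by (rule summable_on_comparison_test) auto
qed

text \<open>Cutting a function off to \<open>A\<close> and to \<open>- A\<close> splits it into two
  summands, both in \<open>lp p\<close> by termwise domination. Only 0 vanishes on both
  sets.\<close>

lemma complemented_lp_vanishing:
  fixes A :: "'a set"
  assumes p: "1 \<le> p"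
  shows "complemented_lp p (lp_vanishing p A)"
  unfolding complemented_lp_def
proof (intro conjI exI)
  show "closed_subspace_lp p (lp_vanishing p A)" "closed_subspace_lp p (lp_vanishing p (- A))"
    by (rule closed_subspace_lp_vanishing[OF p])+
  show "lp_vanishing p A \<inter> lp_vanishing p (- A) = {0}"
    using cfun.subspace_0[OF lp_subspace[OF p]] by (fastforce simp: lp_vanishing_def fun_eq_iff)
  show "{f + g | f g. f \<in> lp_vanishing p A \<and> g \<in> lp_vanishing p (- A)} = lp p"
  proof (intro equalityI subsetI)
    fix h :: "'a \<Rightarrow> complex" assume h: "h \<in> lp p"
    \<comment> \<open>The roles are crossed: the summand vanishing on \<open>A\<close> is the part
      of \<open>h\<close> supported off \<open>A\<close>.\<close>
    define f where "f = (\<lambda>n. if n \<in> - A then h n else 0)"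
    define g where "g = (\<lambda>n. if n \<in> A then h n else 0)"
    have "f \<in> lp_vanishing p A" "g \<in> lp_vanishing p (- A)"
      using lp_restrict[OF h, of "- A"] lp_restrict[OF h, of A]
      by (auto simp: lp_vanishing_def f_def g_def)
    moreover have "h = f + g"
      by (auto simp: f_def g_def fun_eq_iff)
    ultimately show "h \<in> {f + g | f g. f \<in> lp_vanishing p A \<and> g \<in> lp_vanishing p (- A)}"
      by blast
  qed (auto simp: lp_vanishing_def intro: lp_triangle(1)[OF p])
qed

text \<open>Where \<open>u m = 0\<close> the equation at \<open>m\<close> is void; elsewhere
  \<open>u m\<close> cancels and leaves \<open>f (\<phi> m) = 0\<close>.\<close>

lemma null_space_weighted_composition:
  "null_space_lp p (weighted_composition u \<phi>) = lp_vanishing p (\<phi> ` {m. u m \<noteq> 0})"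
  by (auto simp: null_space_lp_def weighted_composition_def lp_vanishing_def fun_eq_iff)

theorem theorem2p10:
  fixes p :: real and u :: "pnat \<Rightarrow> complex" and \<phi> :: "pnat \<Rightarrow> pnat"
  assumes "1 \<le> p"
    and "bounded_operator_lp p (weighted_composition u \<phi>)"
  shows "complemented_lp p (null_space_lp p (weighted_composition u \<phi>))"
  unfolding null_space_weighted_composition by (rule complemented_lp_vanishing[OF assms(1)])

end
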